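(* Let $p$ be a prime, fix an $\mathbb{N}$-grading on $\mathbb{F}_p[x,y]$, and let $f\in\mathbb{F}_p[x,y]$ be a homogeneous polynomial with $\sqrt{\operatorname{Jac}(f)}=(x,y)$ and $\deg f\ge \deg xy$. If $p\nmid \deg f$ and $\operatorname{fpt}(f)\ne \frac{\deg xy}{\deg f}$, then $$\operatorname{fpt}(f)=\frac{\deg xy}{\deg f}-\frac{[\,p^L\cdot\deg xy\ \%\ \deg f\,]}{p^L\cdot \deg f}\quad\text{for some integer } 1\le L\le \operatorname{ord}(p,\deg f).$$
   Context: An $\mathbb{N}$-grading on a polynomial ring over a field is a grading in which field elements have degree $0$ and each variable has a positive integer degree; "homogeneous" (with $f\neq 0$) and $\deg$ refer to this grading, and $\deg xy=\deg x+\deg y$. $\operatorname{Jac}(f)$ is the ideal generated by the partial derivatives of $f$. For integers $m$ and $b>0$, $[\,m\ \%\ b\,]$ is the least positive residue of $m$ modulo $b$, so $1\le[\,m\ \%\ b\,]\le b$. For $p\nmid b$, $\operatorname{ord}(p,b)$ is the least integer $k\ge1$ with $p^k\equiv 1 \bmod b$ (so $\operatorname{ord}(p,1)=1$). With $\mathfrak{m}=(x,y)$ and $\mathfrak{m}^{[p^e]}=(x^{p^e},y^{p^e})$, for $f\in\mathfrak{m}$ set $\nu_f(p^e)=\max\{N: f^N\notin \mathfrak{m}^{[p^e]}\}$; the $F$-pure threshold is $\operatorname{fpt}(f)=\lim_{e\to\infty}\nu_f(p^e)/p^e$ (the limit exists). *)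

theory Defs
  imports
    Complex_Main
    "HOL-Number_Theory.Number_Theory"
    "Berlekamp_Zassenhaus.Finite_Field"
begin

text \<open>
  The ring \<open>k[x,y]\<close> is \<open>k[x][y]\<close>, i.e. the type \<open>'a poly poly\<close>: the coefficient of
  \<open>x\<^sup>i y\<^sup>j\<close> in \<open>f\<close> is \<open>poly.coeff (poly.coeff f j) i\<close>.  The field \<open>\<F>\<^sub>p\<close> is the type
  \<open>'p mod_ring\<close>, where \<open>'p\<close> ranges over the finite types with prime cardinality \<open>p\<close>.
\<close>

definition var_x :: "'a::comm_ring_1 poly poly" where
  "var_x = [:[:0, 1:]:]"

definition var_y :: "'a::comm_ring_1 poly poly" where
  "var_y = [:0, 1:]"

definition partial_x :: "'a::idom poly poly \<Rightarrow> 'a poly poly" where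
  "partial_x f = map_poly pderiv f"

definition partial_y :: "'a::idom poly poly \<Rightarrow> 'a poly poly" where
  "partial_y f = pderiv f"

text \<open>The ideal generated by \<open>S\<close> is the submodule spanned by \<open>S\<close> in the ring as a module over itself.\<close>

definition ideal_generated_by :: "'r::comm_ring_1 set \<Rightarrow> 'r set" where
  "ideal_generated_by S = Modules.module.span (*) S"

definition ideal_radical :: "'r::comm_ring_1 set \<Rightarrow> 'r set" where
  "ideal_radical I = {r. \<exists>n\<ge>1. r ^ n \<in> I}"

definition Jac :: "'a::idom poly poly \<Rightarrow> 'a poly poly set" where
  "Jac f = ideal_generated_by {partial_x f, partial_y f}"

text \<open>
  An \<open>\<nat>\<close>-grading is determined by the positive degrees \<open>a\<close> of \<open>x\<close> and \<open>b\<close> of \<open>y\<close>; the monomial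
  \<open>x\<^sup>i y\<^sup>j\<close> then has degree \<open>a i + b j\<close>.  The value of \<open>wdeg\<close> at \<open>0\<close> is unspecified.
\<close>

definition wdeg :: "nat \<Rightarrow> nat \<Rightarrow> 'a::zero poly poly \<Rightarrow> nat" where
  "wdeg a b f = Max {a * i + b * j | i j. poly.coeff (poly.coeff f j) i \<noteq> 0}"

definition homogeneous :: "nat \<Rightarrow> nat \<Rightarrow> 'a::zero poly poly \<Rightarrow> bool" where
  "homogeneous a b f \<longleftrightarrow>
     f \<noteq> 0 \<and> (\<exists>d. \<forall>i j. poly.coeff (poly.coeff f j) i \<noteq> 0 \<longrightarrow> a * i + b * j = d)"

definition max_ideal :: "'a::comm_ring_1 poly poly set" where
  "max_ideal = ideal_generated_by {var_x, var_y}"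

text \<open>The Frobenius power \<open>(x\<^sup>q, y\<^sup>q)\<close>, for \<open>q\<close> a power of the characteristic.\<close>

definition frob_power :: "nat \<Rightarrow> 'a::comm_ring_1 poly poly set" where
  "frob_power q = ideal_generated_by {var_x ^ q, var_y ^ q}"

text \<open>The set below is finite when \<open>f\<close> lies in the ideal \<open>(x, y)\<close>; \<open>nu\<close> is meant for such \<open>f\<close> only.\<close>

definition nu :: "'a::comm_ring_1 poly poly \<Rightarrow> nat \<Rightarrow> nat" where
  "nu f q = Max {N. f ^ N \<notin> frob_power q}"

definition fpt :: "nat \<Rightarrow> 'a::comm_ring_1 poly poly \<Rightarrow> real" where
  "fpt p f = lim (\<lambda>e. real (nu f (p ^ e)) / real (p ^ e))"

text \<open>Unlike \<open>m mod b\<close>, this is \<open>b\<close>, not \<open>0\<close>, when \<open>b\<close> divides \<open>m\<close>.\<close>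

definition least_pos_residue :: "int \<Rightarrow> int \<Rightarrow> nat" where
  "least_pos_residue m b = (LEAST r::nat. 0 < r \<and> [int r = m] (mod b))"

end

theory Submission
  imports Defs
begin

text \<open>
  Write \<open>A = a + b\<close> for the degree of \<open>xy\<close>, \<open>D\<close> for that of \<open>f\<close>, and \<open>\<nu>\<^sub>e = \<nu>\<^sub>f(p\<^sup>e)\<close>.  Modulo
  \<open>(x\<^sup>q, y\<^sup>q)\<close> the highest surviving monomial is \<open>(xy)\<^sup>q\<^sup>-\<^sup>1\<close>, so comparing degrees bounds \<open>\<nu>\<^sub>e\<close> from
  above by \<open>u\<^sub>e\<close>, the largest integer smaller than \<open>p\<^sup>e A/D\<close>; by definition of the least positive
  residue, \<open>D u\<^sub>e = p\<^sup>e A - [p\<^sup>e A % D]\<close>.  If \<open>\<nu>\<^sub>e = u\<^sub>e\<close> for all \<open>e\<close>, then \<open>fpt(f) = A/D\<close>.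
  Otherwise let \<open>L\<close> be the first exponent with \<open>\<nu>\<^sub>L < u\<^sub>L\<close>; the claim is that
  \<open>fpt(f) = u\<^sub>L/p\<^sup>L\<close>, and this is the formula of the theorem.

  The isolated singularity enters through a lower bound (\<open>exponent_gap\<close>).  If \<open>p\<close> does not divide
  \<open>\<nu>\<^sub>e + 1\<close>, then differentiating \<open>f\<^bsup>\<nu>\<^sub>e + 1\<^esup> \<in> (x\<^sup>q, y\<^sup>q)\<close> shows that \<open>f\<^bsup>\<nu>\<^sub>e\<^esup> Jac(f)\<close> lies in
  \<open>(x\<^sup>q, y\<^sup>q)\<close>, as derivations map this ideal to itself in characteristic \<open>p\<close>.  Multiplying \<open>f\<^bsup>\<nu>\<^sub>e\<^esup>\<close>
  by a suitable monomial \<open>h\<close> hits \<open>(xy)\<^sup>q\<^sup>-\<^sup>1\<close>, so \<open>h\<close> is outside \<open>Jac(f)\<close>; but the quotient by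
  \<open>Jac(f)\<close> is a graded complete intersection whose top degree is \<open>(D - a) + (D - b) - A\<close>
  (\<open>homogeneous_complete_intersection_top_degree\<close>).  Hence \<open>\<nu>\<^sub>e + 2 > p\<^sup>e A/D\<close>.

  The rest is arithmetic with \<open>p \<nu>\<^sub>e \<le> \<nu>\<^sub>e\<^sub>+\<^sub>1 < p (\<nu>\<^sub>e + 1)\<close>.  At the first deviation \<open>L\<close> the number
  \<open>\<nu>\<^sub>L + 1\<close> is not divisible by \<open>p\<close>, so \<open>\<nu>\<^sub>L + 1 = u\<^sub>L\<close>; and afterwards a step with \<open>p\<close> not dividing
  \<open>\<nu>\<^sub>e + 1\<close> would contradict the lower bound, so \<open>\<nu>\<^sub>e + 1 = p\<^sup>e\<^sup>-\<^sup>L u\<^sub>L\<close> (\<open>first_deviation\<close>).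

  Finally \<open>L \<le> o\<close> for \<open>o = ord(p, D)\<close>.  The residue of \<open>p\<^sup>o A\<close> is \<open>A\<close> itself, so if there were no
  deviation up to \<open>o\<close>, the power \<open>f\<^bsup>\<nu>\<^sub>o\<^esup>\<close> would be a nonzero multiple of \<open>(xy)\<^bsup>p\<^sup>o - 1\<^esup>\<close> modulo
  \<open>(x\<^bsup>p\<^sup>o\<^esup>, y\<^bsup>p\<^sup>o\<^esup>)\<close>.  This propagates along the powers of \<open>p\<^sup>o\<close> (\<open>nu_Frobenius_periodic\<close>), which
  the formula for \<open>\<nu>\<^sub>e\<close> beyond a deviation rules out.
\<close>

section \<open>Coefficients of polynomials in two variables\<close>

abbreviation bicoeff :: "'a::zero poly poly \<Rightarrow> nat \<Rightarrow> nat \<Rightarrow> 'a" where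
  "bicoeff f i j \<equiv> coeff (coeff f j) i"

abbreviation bimonom :: "'a::zero \<Rightarrow> nat \<Rightarrow> nat \<Rightarrow> 'a poly poly" where
  "bimonom c i j \<equiv> monom (monom c i) j"

lemma bipoly_eqI: "(\<And>i j. bicoeff f i j = bicoeff g i j) \<Longrightarrow> f = g"
  by (simp add: poly_eq_iff)

lemma bicoeff_add: "bicoeff (f + g) i j = bicoeff f i j + bicoeff g i j"
  for f g :: "'a::comm_monoid_add poly poly"
  by simp

lemma bicoeff_mult:
  "bicoeff (f * g) i j = (\<Sum>j'\<le>j. \<Sum>i'\<le>i. bicoeff f i' j' * bicoeff g (i - i') (j - j'))"
  for f g :: "'a::comm_ring_1 poly poly"
  by (simp add: coeff_mult coeff_sum)

lemma bicoeff_bimonom: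
  "bicoeff (bimonom c k l) i j = (if i = k \<and> j = l then c else 0)"
  by auto

lemma bicoeff_bimonom_mult:
  "bicoeff (bimonom c k l * g) i j = (if k \<le> i \<and> l \<le> j then c * bicoeff g (i - k) (j - l) else 0)"
  for g :: "'a::comm_ring_1 poly poly"
  by (simp add: coeff_monom_mult)

lemma var_x_power: "(var_x :: 'a::comm_ring_1 poly poly) ^ n = bimonom 1 n 0"
proof -
  have eq: "(var_x :: 'a poly poly) = bimonom 1 1 0"
    by (simp add: var_x_def monom_0 monom_Suc)
  show ?thesis unfolding eq by (simp add: monom_power)
qed

lemma var_y_power: "(var_y :: 'a::comm_ring_1 poly poly) ^ n = bimonom 1 0 n"
proof -
  have eq: "(var_y :: 'a poly poly) = bimonom 1 0 1"
    by (simp add: var_y_def monom_0 monom_Suc)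
  show ?thesis unfolding eq by (simp add: monom_power)
qed

lemma finite_bisupport: "finite {(i, j). bicoeff f i j \<noteq> 0}"
proof (rule finite_subset)
  show "{(i, j). bicoeff f i j \<noteq> 0} \<subseteq> (\<Union>j\<le>degree f. (\<lambda>i. (i, j)) ` {..degree (coeff f j)})"
  proof clarify
    fix i j assume "bicoeff f i j \<noteq> 0"
    then have "i \<le> degree (coeff f j)" "j \<le> degree f" by (auto intro!: le_degree)
    then show "(i, j) \<in> (\<Union>j\<le>degree f. (\<lambda>i. (i, j)) ` {..degree (coeff f j)})" by blast
  qed
qed auto

lemma bicoeff_sum_bimonom:
  fixes c :: "nat \<Rightarrow> nat \<Rightarrow> 'a::comm_ring_1"
  assumes "finite S"
  shows "bicoeff (\<Sum>(i, j)\<in>S. bimonom (c i j) i j) k l = (if (k, l) \<in> S then c k l else 0)"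
proof -
  have "bicoeff (\<Sum>(i, j)\<in>S. bimonom (c i j) i j) k l = (\<Sum>ij\<in>S. if ij = (k, l) then c k l else 0)"
    unfolding coeff_sum by (rule sum.cong) (auto split: if_splits prod.splits)
  then show ?thesis using assms by (simp add: sum.delta')
qed

lemma bipoly_eq_sum_bimonom:
  "f = (\<Sum>(i, j)\<in>{(i, j). bicoeff f i j \<noteq> 0}. bimonom (bicoeff f i j) i j)"
  for f :: "'a::comm_ring_1 poly poly"
proof (rule bipoly_eqI)
  show "bicoeff f i j = bicoeff (\<Sum>(i, j)\<in>{(i, j). bicoeff f i j \<noteq> 0}. bimonom (bicoeff f i j) i j) i j"
    for i j
    by (subst bicoeff_sum_bimonom[OF finite_bisupport]) auto
qed

section \<open>Ideals\<close>

lemma ideal_generated_by_pair_iff: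
  "g \<in> ideal_generated_by {u, v} \<longleftrightarrow> (\<exists>s t. g = s * u + t * v)"
  for g :: "'r::comm_ring_1"
proof -
  interpret Modules.module "(*) :: 'r \<Rightarrow> 'r \<Rightarrow> 'r"
    by unfold_locales (simp_all add: algebra_simps)
  show ?thesis
    unfolding ideal_generated_by_def
    by (simp only: span_breakdown_eq span_empty singleton_iff right_minus_eq diff_diff_eq)
qed

lemma ideal_generated_by_pair_mult:
  "g \<in> ideal_generated_by {u, v} \<Longrightarrow> h * g \<in> ideal_generated_by {u, v}"
  for g :: "'r::comm_ring_1"
proof -
  assume "g \<in> ideal_generated_by {u, v}"
  then obtain s t where "g = s * u + t * v" unfolding ideal_generated_by_pair_iff by blast
  then have "h * g = (h * s) * u + (h * t) * v" by (simp add: algebra_simps)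
  then show ?thesis unfolding ideal_generated_by_pair_iff by blast
qed

lemma frob_power_iff:
  "g \<in> frob_power q \<longleftrightarrow> (\<forall>i<q. \<forall>j<q. bicoeff g i j = 0)"
  for g :: "'a::comm_ring_1 poly poly"
proof
  assume "g \<in> frob_power q"
  then obtain s t where "g = s * var_x ^ q + t * var_y ^ q"
    unfolding frob_power_def ideal_generated_by_pair_iff by blast
  then have "g = bimonom 1 q 0 * s + bimonom 1 0 q * t"
    by (simp add: var_x_power var_y_power mult.commute)
  then show "\<forall>i<q. \<forall>j<q. bicoeff g i j = 0"
    by (simp only: bicoeff_add bicoeff_bimonom_mult) simp
next
  assume vanish: "\<forall>i<q. \<forall>j<q. bicoeff g i j = 0"
  define S where "S = {(i, j). bicoeff g i j \<noteq> 0}"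
  define s where "s = (\<Sum>(i, j)\<in>{(i, j) \<in> S. q \<le> i}. bimonom (bicoeff g i j) (i - q) j)"
  define t where "t = (\<Sum>(i, j)\<in>{(i, j) \<in> S. \<not> q \<le> i}. bimonom (bicoeff g i j) i (j - q))"
  have fin: "finite S" unfolding S_def by (rule finite_bisupport)
  have "g = (\<Sum>(i, j)\<in>S. bimonom (bicoeff g i j) i j)"
    unfolding S_def by (rule bipoly_eq_sum_bimonom)
  also have "\<dots> = (\<Sum>(i, j)\<in>{(i, j) \<in> S. q \<le> i} \<union> {(i, j) \<in> S. \<not> q \<le> i}. bimonom (bicoeff g i j) i j)"
    by (rule sum.cong) auto
  also have "\<dots> = (\<Sum>(i, j)\<in>{(i, j) \<in> S. q \<le> i}. bimonom (bicoeff g i j) i j)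
                + (\<Sum>(i, j)\<in>{(i, j) \<in> S. \<not> q \<le> i}. bimonom (bicoeff g i j) i j)"
    by (rule sum.union_disjoint) (auto intro: finite_subset[OF _ fin])
  also have "(\<Sum>(i, j)\<in>{(i, j) \<in> S. q \<le> i}. bimonom (bicoeff g i j) i j) = s * var_x ^ q"
    unfolding s_def sum_distrib_right var_x_power
    by (rule sum.cong) (auto simp: mult_monom)
  also have "(\<Sum>(i, j)\<in>{(i, j) \<in> S. \<not> q \<le> i}. bimonom (bicoeff g i j) i j) = t * var_y ^ q"
    unfolding t_def sum_distrib_right var_y_power
  proof (rule sum.cong, rule refl, clarify)
    fix i j assume "(i, j) \<in> S" "\<not> q \<le> i"
    then have "q \<le> j" using vanish by (auto simp: S_def not_le[symmetric])
    then show "bimonom (bicoeff g i j) i j = bimonom (bicoeff g i j) i (j - q) * bimonom 1 0 q"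
      by (simp only: mult_monom) simp
  qed
  finally show "g \<in> frob_power q"
    unfolding frob_power_def ideal_generated_by_pair_iff by blast
qed

lemma frob_power_add: "g \<in> frob_power q \<Longrightarrow> h \<in> frob_power q \<Longrightarrow> g + h \<in> frob_power q"
  for g :: "'a::comm_ring_1 poly poly"
  by (simp add: frob_power_iff)

lemma frob_power_diff: "g \<in> frob_power q \<Longrightarrow> h \<in> frob_power q \<Longrightarrow> g - h \<in> frob_power q"
  for g :: "'a::comm_ring_1 poly poly"
  by (simp add: frob_power_iff)

lemma frob_power_mult: "g \<in> frob_power q \<Longrightarrow> h * g \<in> frob_power q"
  for g :: "'a::comm_ring_1 poly poly"
  unfolding frob_power_def by (rule ideal_generated_by_pair_mult)

text \<open>
  This is the inclusion \<open>(X, Y) : \<Delta> \<subseteq> (u, v)\<close> of Wiebe's theorem, for a regular sequence \<open>X, Y\<close>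
  expressed through \<open>u, v\<close> by a matrix of determinant \<open>\<Delta>\<close>.  By Cramer's rule \<open>\<Delta> u\<close> and \<open>\<Delta> v\<close> are combinations of \<open>X\<close> and \<open>Y\<close>, and comparing two
  expressions for \<open>\<Delta> h u\<close> gives a syzygy of \<open>X, Y\<close>, which is a multiple of the trivial one.
  That multiple, \<open>w\<close>, is the coefficient of \<open>v\<close>.  Stating regularity as a divisibility avoids
  any appeal to unique factorization.
\<close>

lemma regular_pair_determinant:
  fixes u v X Y :: "'r::idom"
  assumes X: "X = \<alpha> * u + \<beta> * v" and Y: "Y = \<gamma> * u + \<epsilon> * v"
    and regular: "\<And>P Q. P * Y = Q * X \<Longrightarrow> X dvd P"
    and "X \<noteq> 0"
    and det: "(\<alpha> * \<epsilon> - \<beta> * \<gamma>) * h = s * X + t * Y"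
  shows "h \<in> ideal_generated_by {u, v}"
proof -
  have "u * (s * X + t * Y) = h * (\<epsilon> * X - \<beta> * Y)"
    unfolding det[symmetric] by (simp add: X Y algebra_simps)
  then have syz: "(h * \<beta> + u * t) * Y = (h * \<epsilon> - u * s) * X"
    by (simp add: algebra_simps)
  then obtain w where w: "h * \<beta> + u * t = X * w"
    using regular by blast
  then have "X * (w * Y) = X * (h * \<epsilon> - u * s)"
    using syz by (simp add: algebra_simps)
  then have w': "h * \<epsilon> - u * s = w * Y" using \<open>X \<noteq> 0\<close> by simp
  \<comment> \<open>It remains to divide \<open>k\<close> by \<open>u\<close>. Now \<open>u\<close> divides \<open>k \<beta>\<close> and \<open>k \<epsilon>\<close>, hence also \<open>k X\<close> and \<open>k Y\<close>.\<close>
  define k where "k = h - w * v"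
  have k\<beta>: "k * \<beta> = u * (w * \<alpha> - t)"
    using w by (simp add: k_def X algebra_simps)
  have k\<epsilon>: "k * \<epsilon> = u * (s + w * \<gamma>)"
    using w' by (simp add: k_def Y algebra_simps)
  define P where "P = k * \<alpha> + (w * \<alpha> - t) * v"
  define Q where "Q = k * \<gamma> + (s + w * \<gamma>) * v"
  have "k * X = k * \<alpha> * u + (k * \<beta>) * v" by (simp add: X algebra_simps)
  then have kX: "k * X = u * P" unfolding k\<beta> P_def by (simp add: algebra_simps)
  have "k * Y = k * \<gamma> * u + (k * \<epsilon>) * v" by (simp add: Y algebra_simps)
  then have kY: "k * Y = u * Q" unfolding k\<epsilon> Q_def by (simp add: algebra_simps)
  have "u dvd k"
  proof (cases "u = 0")
    case True
    then show ?thesis using kX \<open>X \<noteq> 0\<close> by simp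
  next
    case False
    have "u * (P * Y) = u * (Q * X)"
      using kX kY by (metis mult.assoc mult.commute)
    then have "P * Y = Q * X" using False by simp
    then obtain k' where "P = X * k'" using regular by blast
    then have "k = u * k'" using kX \<open>X \<noteq> 0\<close>
      by (metis mult.left_commute mult.commute mult_cancel_right)
    then show ?thesis by simp
  qed
  then obtain k' where "k = u * k'" ..
  then have "h = k' * u + w * v" by (simp add: k_def algebra_simps)
  then show ?thesis unfolding ideal_generated_by_pair_iff by blast
qed

lemma bimonom_regular_sequence:
  fixes P Q :: "'a::comm_ring_1 poly poly"
  assumes "P * bimonom 1 0 N = Q * bimonom 1 N 0"
  shows "bimonom 1 N 0 dvd P"
proof -
  have eq: "bimonom 1 0 N * P = bimonom 1 N 0 * Q" using assms by (simp add: mult.commute)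
  have zero: "bicoeff P i j = 0" if "i < N" for i j
    using arg_cong[OF eq, of "\<lambda>g. bicoeff g i (j + N)"] that
    unfolding bicoeff_bimonom_mult by simp
  define S where "S = {(i, j). bicoeff P i j \<noteq> 0}"
  have "P = (\<Sum>(i, j)\<in>S. bimonom (bicoeff P i j) i j)"
    unfolding S_def by (rule bipoly_eq_sum_bimonom)
  also have "bimonom 1 N 0 dvd \<dots>"
  proof (rule dvd_sum, clarify)
    fix i j assume "(i, j) \<in> S"
    then have "N \<le> i" using zero by (force simp: S_def not_less[symmetric])
    then have "bimonom (bicoeff P i j) i j = bimonom 1 N 0 * bimonom (bicoeff P i j) (i - N) j"
      by (simp add: mult_monom)
    then show "bimonom 1 N 0 dvd bimonom (bicoeff P i j) i j" by (rule dvdI)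
  qed
  finally show ?thesis .
qed

section \<open>Weighted homogeneous polynomials\<close>

text \<open>
  The degree is an integer and the zero polynomial is homogeneous of every degree, so that
  cofactors and partial derivatives of nominally negative degree need no special treatment.
\<close>

definition whomog :: "nat \<Rightarrow> nat \<Rightarrow> int \<Rightarrow> 'a::zero poly poly \<Rightarrow> bool" where
  "whomog a b \<delta> f \<longleftrightarrow> (\<forall>i j. bicoeff f i j \<noteq> 0 \<longrightarrow> int (a * i + b * j) = \<delta>)"

definition wcomp :: "nat \<Rightarrow> nat \<Rightarrow> int \<Rightarrow> 'a::comm_ring_1 poly poly \<Rightarrow> 'a poly poly" where
  "wcomp a b \<delta> f =
     (\<Sum>(i, j)\<in>{(i, j). bicoeff f i j \<noteq> 0 \<and> int (a * i + b * j) = \<delta>}. bimonom (bicoeff f i j) i j)"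

lemma bicoeff_wcomp:
  "bicoeff (wcomp a b \<delta> f) i j = (if int (a * i + b * j) = \<delta> then bicoeff f i j else 0)"
proof -
  have "finite {(i, j). bicoeff f i j \<noteq> 0 \<and> int (a * i + b * j) = \<delta>}"
    by (rule finite_subset[OF _ finite_bisupport[of f]]) auto
  then show ?thesis unfolding wcomp_def by (subst bicoeff_sum_bimonom) auto
qed

lemma whomog_wcomp: "whomog a b \<delta> (wcomp a b \<delta> f)"
  unfolding whomog_def bicoeff_wcomp by simp

lemma wcomp_whomog: "whomog a b \<delta> f \<Longrightarrow> wcomp a b \<delta> f = f"
  by (rule bipoly_eqI) (auto simp: whomog_def bicoeff_wcomp)

lemma wcomp_add: "wcomp a b \<delta> (f + g) = wcomp a b \<delta> f + wcomp a b \<delta> g"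
  by (rule bipoly_eqI) (simp add: bicoeff_wcomp)

lemma wcomp_mult_whomog:
  assumes "whomog a b m u"
  shows "wcomp a b \<delta> (s * u) = wcomp a b (\<delta> - m) s * u"
proof (rule bipoly_eqI)
  fix i j
  have "(if int (a * i + b * j) = \<delta> then bicoeff s i' j' * bicoeff u (i - i') (j - j') else 0) =
        bicoeff (wcomp a b (\<delta> - m) s) i' j' * bicoeff u (i - i') (j - j')"
    if le: "i' \<le> i" "j' \<le> j" for i' j'
  proof (cases "bicoeff u (i - i') (j - j') = 0")
    case False
    then have m: "int (a * (i - i') + b * (j - j')) = m"
      using assms unfolding whomog_def by blast
    obtain k l where "i = i' + k" "j = j' + l" using le unfolding le_iff_add by blast
    with m have "int (a * i + b * j) = \<delta> \<longleftrightarrow> int (a * i' + b * j') = \<delta> - m"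
      by (auto simp: algebra_simps)
    then show ?thesis by (simp only: bicoeff_wcomp) simp
  qed simp
  then show "bicoeff (wcomp a b \<delta> (s * u)) i j = bicoeff (wcomp a b (\<delta> - m) s * u) i j"
    unfolding bicoeff_wcomp[of a b \<delta>] bicoeff_mult
    by (auto intro!: sum.cong sum.neutral simp del: mult_eq_0_iff)
qed

text \<open>
  Projecting the given identity to degree \<open>\<delta>\<close> replaces its coefficients by homogeneous ones.
\<close>

lemma whomog_combination:
  assumes "whomog a b m u" "whomog a b n v" "g = s * u + t * v" "whomog a b \<delta> g"
  shows "g = wcomp a b (\<delta> - m) s * u + wcomp a b (\<delta> - n) t * v"
proof -
  have "g = wcomp a b \<delta> g" using assms(4) by (simp only: wcomp_whomog)
  also have "\<dots> = wcomp a b \<delta> (s * u) + wcomp a b \<delta> (t * v)"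
    unfolding assms(3) by (rule wcomp_add)
  finally show ?thesis unfolding wcomp_mult_whomog[OF assms(1)] wcomp_mult_whomog[OF assms(2)] .
qed

lemma whomog_mult:
  fixes f g :: "'a::comm_ring_1 poly poly"
  assumes "whomog a b m f" "whomog a b n g"
  shows "whomog a b (m + n) (f * g)"
proof -
  have "wcomp a b (m + n) (f * g) = f * g"
    using wcomp_mult_whomog[OF assms(2), of "m + n" f] assms(1) by (simp add: wcomp_whomog)
  then show ?thesis by (metis whomog_wcomp)
qed

lemma whomog_power:
  fixes f :: "'a::comm_ring_1 poly poly"
  assumes "whomog a b m f" 
  shows "whomog a b (int n * m) (f ^ n)"
proof (induction n)
  case 0
  show ?case by (simp add: whomog_def coeff_1)
next
  case (Suc n)
  then show ?case using whomog_mult[OF assms Suc] by (simp add: algebra_simps)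
qed

lemma whomog_bimonom: "whomog a b (int (a * i + b * j)) (bimonom c i j)"
  by (simp add: whomog_def)

lemma whomog_diff:
  "whomog a b m f \<Longrightarrow> whomog a b m g \<Longrightarrow> whomog a b m (f - g)"
  for f g :: "'a::comm_ring_1 poly poly"
  unfolding whomog_def coeff_diff by (metis diff_self)

text \<open>
  Outside \<open>(x\<^sup>q, y\<^sup>q)\<close> some monomial has both exponents at most \<open>q - 1\<close>.
\<close>

lemma whomog_not_in_frob_power:
  assumes "whomog a b \<delta> g" "g \<notin> frob_power q"
  shows "\<delta> \<le> (int q - 1) * (int a + int b)"
proof -
  obtain i j where ij: "i < q" "j < q" "bicoeff g i j \<noteq> 0"
    using assms(2) by (auto simp: frob_power_iff)
  then have "\<delta> = int a * int i + int b * int j" using assms(1) by (force simp: whomog_def)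
  also have "\<dots> \<le> int a * (int q - 1) + int b * (int q - 1)"
    using ij by (intro add_mono mult_left_mono) auto
  finally show ?thesis by (simp add: algebra_simps)
qed

text \<open>
  The expected socle degree of the complete intersection \<open>(u, v)\<close>, obtained without Hilbert series
  by comparison with \<open>(x\<^sup>N, y\<^sup>N)\<close>, whose top degree \<open>(N - 1) (a + b)\<close> is visible: multiplication by
  the determinant \<open>\<Delta>\<close> of a transition matrix embeds the quotient by \<open>(u, v)\<close> into the quotient by \<open>(x\<^sup>N, y\<^sup>N)\<close> and raises
  degrees by \<open>N (a + b) - m - n\<close>.
\<close>

lemma homogeneous_complete_intersection_top_degree:
  fixes u v h :: "'a::idom poly poly"
  assumes u: "whomog a b m u" and v: "whomog a b n v"
    and x: "var_x ^ N \<in> ideal_generated_by {u, v}" and y: "var_y ^ N \<in> ideal_generated_by {u, v}"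
    and h: "whomog a b \<delta> h" "h \<notin> ideal_generated_by {u, v}"
  shows "\<delta> \<le> m + n - (int a + int b)"
proof -
  define X :: "'a poly poly" where "X = bimonom 1 N 0"
  define Y :: "'a poly poly" where "Y = bimonom 1 0 N"
  obtain \<alpha>0 \<beta>0 where "X = \<alpha>0 * u + \<beta>0 * v"
    using x unfolding ideal_generated_by_pair_iff var_x_power X_def by blast
  moreover have "whomog a b (int a * int N) X"
    using whomog_bimonom[of a b N 0 1] unfolding X_def by simp
  ultimately have X: "X = wcomp a b (int a * int N - m) \<alpha>0 * u + wcomp a b (int a * int N - n) \<beta>0 * v"
    using whomog_combination[OF u v] by blast
  obtain \<gamma>0 \<epsilon>0 where "Y = \<gamma>0 * u + \<epsilon>0 * v"
    using y unfolding ideal_generated_by_pair_iff var_y_power Y_def by blast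
  moreover have "whomog a b (int b * int N) Y"
    using whomog_bimonom[of a b 0 N "1::'a"] unfolding Y_def
    by (simp only: mult_0_right add_0 of_nat_mult)
  ultimately have Y: "Y = wcomp a b (int b * int N - m) \<gamma>0 * u + wcomp a b (int b * int N - n) \<epsilon>0 * v"
    using whomog_combination[OF u v] by blast
  define \<Delta> where "\<Delta> = wcomp a b (int a * int N - m) \<alpha>0 * wcomp a b (int b * int N - n) \<epsilon>0
    - wcomp a b (int a * int N - n) \<beta>0 * wcomp a b (int b * int N - m) \<gamma>0"
  have "whomog a b ((int a * int N - m) + (int b * int N - n)) \<Delta>"
    unfolding \<Delta>_def
  proof (rule whomog_diff)
    have "(int a * int N - n) + (int b * int N - m) = (int a * int N - m) + (int b * int N - n)"
      by simp
    then show "whomog a b ((int a * int N - m) + (int b * int N - n))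
        (wcomp a b (int a * int N - n) \<beta>0 * wcomp a b (int b * int N - m) \<gamma>0)"
      using whomog_mult[OF whomog_wcomp whomog_wcomp] by metis
  qed (intro whomog_mult whomog_wcomp)
  then have deg: "whomog a b (((int a * int N - m) + (int b * int N - n)) + \<delta>) (\<Delta> * h)"
    using h(1) by (rule whomog_mult)
  have "\<Delta> * h \<notin> frob_power N"
  proof
    assume "\<Delta> * h \<in> frob_power N"
    then obtain s t where "\<Delta> * h = s * X + t * Y"
      unfolding frob_power_def ideal_generated_by_pair_iff X_def Y_def var_x_power var_y_power
      by blast
    moreover have "X \<noteq> 0" by (simp add: X_def monom_eq_0_iff)
    ultimately have "h \<in> ideal_generated_by {u, v}"
      using regular_pair_determinant[OF X Y] bimonom_regular_sequence
      unfolding \<Delta>_def X_def Y_def by blast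
    with h(2) show False by blast
  qed
  from whomog_not_in_frob_power[OF deg this] show ?thesis
    by (simp add: algebra_simps)
qed

section \<open>Derivatives and Frobenius powers\<close>

lemma bicoeff_partial_x: "bicoeff (partial_x f) i j = of_nat (Suc i) * bicoeff f (Suc i) j"
  by (simp add: partial_x_def coeff_map_poly coeff_pderiv)

lemma bicoeff_partial_y: "bicoeff (partial_y f) i j = of_nat (Suc j) * bicoeff f i (Suc j)"
  by (simp add: partial_y_def coeff_pderiv of_nat_poly del: of_nat_Suc)

lemma partial_x_mult: "partial_x (f * g) = partial_x f * g + f * partial_x g"
proof (rule poly_eqI)
  fix n
  show "coeff (partial_x (f * g)) n = coeff (partial_x f * g + f * partial_x g) n"
    unfolding partial_x_def coeff_add coeff_mult coeff_map_poly[of pderiv, OF pderiv_0] pderiv_sum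
      pderiv_mult sum.distrib[symmetric]
    by (rule sum.cong) (simp_all add: algebra_simps)
qed

lemma partial_x_power_Suc: "partial_x (f ^ Suc n) = of_nat (Suc n) * (f ^ n * partial_x f)"
proof (induction n)
  case (Suc n)
  have "partial_x (f ^ Suc (Suc n)) = partial_x f * f ^ Suc n + f * partial_x (f ^ Suc n)"
    by (simp only: power_Suc[of f "Suc n"] partial_x_mult)
  then show ?case unfolding Suc by (simp add: algebra_simps)
qed simp

lemma partial_y_power_Suc: "partial_y (f ^ Suc n) = of_nat (Suc n) * (f ^ n * partial_y f)"
  unfolding partial_y_def pderiv_power_Suc by (simp add: of_nat_poly del: of_nat_Suc)

lemma whomog_partial_x: "whomog a b d f \<Longrightarrow> whomog a b (d - int a) (partial_x f)"
  unfolding whomog_def bicoeff_partial_x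
proof (intro allI impI)
  fix i j
  assume f: "\<forall>i j. bicoeff f i j \<noteq> 0 \<longrightarrow> int (a * i + b * j) = d"
    and "of_nat (Suc i) * bicoeff f (Suc i) j \<noteq> 0"
  then have "bicoeff f (Suc i) j \<noteq> 0" by auto
  with f have "int (a * Suc i + b * j) = d" by blast
  then show "int (a * i + b * j) = d - int a" by (simp add: algebra_simps)
qed

lemma whomog_partial_y: "whomog a b d f \<Longrightarrow> whomog a b (d - int b) (partial_y f)"
  unfolding whomog_def bicoeff_partial_y
proof (intro allI impI)
  fix i j
  assume f: "\<forall>i j. bicoeff f i j \<noteq> 0 \<longrightarrow> int (a * i + b * j) = d"
    and "of_nat (Suc j) * bicoeff f i (Suc j) \<noteq> 0"
  then have "bicoeff f i (Suc j) \<noteq> 0" by auto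
  with f have "int (a * i + b * Suc j) = d" by blast
  then show "int (a * i + b * j) = d - int b" by (simp add: algebra_simps)
qed

text \<open>
  The ideal \<open>(x\<^sup>q, y\<^sup>q)\<close> is generated by constants for both derivations when \<open>q = 0\<close> in the ring,
  so they map it to itself.
\<close>

lemma frob_power_partial:
  fixes g :: "'a::idom poly poly"
  assumes "of_nat q = (0::'a)" "g \<in> frob_power q"
  shows "partial_x g \<in> frob_power q" "partial_y g \<in> frob_power q"
proof -
  have "of_nat (Suc i) * bicoeff g (Suc i) j = 0" "of_nat (Suc i) * bicoeff g j (Suc i) = 0"
    if "i < q" "j < q" for i j
    using that assms by (cases "Suc i = q"; force simp: frob_power_iff simp del: of_nat_Suc)+
  then show "partial_x g \<in> frob_power q" "partial_y g \<in> frob_power q"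
    by (auto simp only: frob_power_iff bicoeff_partial_x bicoeff_partial_y)
qed

lemma frob_power_of_nat_mult_cancel:
  fixes g :: "'a::idom poly poly"
  assumes "of_nat n \<noteq> (0::'a)" "of_nat n * g \<in> frob_power q"
  shows "g \<in> frob_power q"
  using assms by (simp add: frob_power_iff of_nat_poly)

text \<open>
  Differentiating \<open>f\<^bsup>n+1\<^esup>\<close> puts \<open>f\<^sup>n Jac(f)\<close> into \<open>(x\<^sup>q, y\<^sup>q)\<close>.  A monomial \<open>h\<close> complementary to a
  surviving monomial of \<open>f\<^sup>n\<close> keeps \<open>h f\<^sup>n\<close> outside, so \<open>h\<close> is not in \<open>Jac(f)\<close>, and its degree
  \<open>(q - 1)(a + b) - n d\<close> is at most the top degree \<open>2 d - 2 (a + b)\<close> modulo the Jacobian ideal.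
\<close>

lemma exponent_gap:
  fixes f :: "'a::idom poly poly"
  assumes f: "whomog a b d f"
    and Jac: "var_x ^ N \<in> Jac f" "var_y ^ N \<in> Jac f"
    and q: "of_nat q = (0::'a)" and n: "of_nat (Suc n) \<noteq> (0::'a)"
    and out: "f ^ n \<notin> frob_power q" and inside: "f ^ Suc n \<in> frob_power q"
  shows "(int q + 1) * (int a + int b) \<le> d * (int n + 2)"
proof -
  have dx: "f ^ n * partial_x f \<in> frob_power q"
    using frob_power_partial(1)[OF q inside] frob_power_of_nat_mult_cancel[OF n]
    unfolding partial_x_power_Suc by blast
  have dy: "f ^ n * partial_y f \<in> frob_power q"
    using frob_power_partial(2)[OF q inside] frob_power_of_nat_mult_cancel[OF n]
    unfolding partial_y_power_Suc by blast
  obtain i j where ij: "i < q" "j < q" "bicoeff (f ^ n) i j \<noteq> 0"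
    using out by (auto simp: frob_power_iff)
  define h :: "'a poly poly" where "h = bimonom 1 (q - 1 - i) (q - 1 - j)"
  have "bicoeff (h * f ^ n) (q - 1) (q - 1) \<noteq> 0"
  proof -
    have "q - 1 - i \<le> q - 1" "q - 1 - j \<le> q - 1"
      "q - 1 - (q - 1 - i) = i" "q - 1 - (q - 1 - j) = j"
      using ij by linarith+
    then show ?thesis
      unfolding h_def bicoeff_bimonom_mult using ij(3) by (simp only: simp_thms if_True mult_1_left)
  qed
  then have hout: "h * f ^ n \<notin> frob_power q"
    using ij unfolding frob_power_iff by (metis diff_less less_nat_zero_code neq0_conv zero_less_one)
  have "h \<notin> ideal_generated_by {partial_x f, partial_y f}"
  proof
    assume "h \<in> ideal_generated_by {partial_x f, partial_y f}"
    then obtain s t where "h = s * partial_x f + t * partial_y f"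
      unfolding ideal_generated_by_pair_iff by blast
    then have "h * f ^ n = s * (f ^ n * partial_x f) + t * (f ^ n * partial_y f)"
      by (simp add: algebra_simps)
    with hout show False using frob_power_add frob_power_mult dx dy by metis
  qed
  moreover have "whomog a b (int (a * (q - 1 - i) + b * (q - 1 - j))) h"
    unfolding h_def by (rule whomog_bimonom)
  ultimately have "int (a * (q - 1 - i) + b * (q - 1 - j))
      \<le> (d - int a) + (d - int b) - (int a + int b)"
    using homogeneous_complete_intersection_top_degree
      [OF whomog_partial_x[OF f] whomog_partial_y[OF f]] Jac
    unfolding Jac_def by blast
  moreover have "int (q - 1 - i) = int q - 1 - int i" "int (q - 1 - j) = int q - 1 - int j"
    using ij by linarith+
  then have "int (a * (q - 1 - i) + b * (q - 1 - j))
      = int a * (int q - 1 - int i) + int b * (int q - 1 - int j)"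
    by (simp only: of_nat_add of_nat_mult)
  moreover have "int (a * i + b * j) = int n * d"
    using whomog_power[OF f, of n] ij unfolding whomog_def by blast
  ultimately show ?thesis by (simp add: algebra_simps)
qed

section \<open>The Frobenius endomorphism\<close>

text \<open>
  Taking \<open>q\<close>-th powers is additive, hence acts on each term separately.
\<close>

lemma bicoeff_frobenius:
  fixes f :: "'a::idom poly poly"
  assumes "prime CHAR('a)" and q: "q = CHAR('a) ^ e"
  shows "bicoeff (f ^ q) i j
    = (if q dvd i \<and> q dvd j then bicoeff f (i div q) (j div q) ^ q else 0)"
proof -
  have "q > 0" using assms by (simp add: prime_gt_0_nat)
  define S where "S = {(i, j). bicoeff f i j \<noteq> 0}"
  have fin: "finite S" unfolding S_def by (rule finite_bisupport)
  have "f ^ q = (\<Sum>(i, j)\<in>S. bimonom (bicoeff f i j) i j) ^ q"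
    unfolding S_def by (subst bipoly_eq_sum_bimonom[of f]) (rule refl)
  also have "\<dots> = (\<Sum>ij\<in>S. (case ij of (i, j) \<Rightarrow> bimonom (bicoeff f i j) i j) ^ q)"
    by (rule freshmans_dream_sum'[where n = e]) (use assms in simp_all)
  also have "\<dots> = (\<Sum>(k, l)\<in>S. bimonom (bicoeff f k l ^ q) (k * q) (l * q))"
    by (rule sum.cong) (auto simp: monom_power)
  finally have fq: "f ^ q = (\<Sum>(k, l)\<in>S. bimonom (bicoeff f k l ^ q) (k * q) (l * q))" .
  have "bicoeff (f ^ q) i j =
      (\<Sum>kl\<in>S. if i = fst kl * q \<and> j = snd kl * q then bicoeff f (fst kl) (snd kl) ^ q else 0)"
    unfolding fq coeff_sum by (rule sum.cong) (auto split: prod.splits)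
  also have "\<dots> = (if q dvd i \<and> q dvd j then bicoeff f (i div q) (j div q) ^ q else 0)"
  proof (cases "q dvd i \<and> q dvd j")
    case True
    then obtain k l where kl: "i = k * q" "j = l * q" by (metis dvd_div_mult_self)
    have "(\<Sum>kl\<in>S. if i = fst kl * q \<and> j = snd kl * q then bicoeff f (fst kl) (snd kl) ^ q else 0)
        = (\<Sum>kl'\<in>S. if kl' = (k, l) then bicoeff f k l ^ q else 0)"
      using \<open>q > 0\<close> by (intro sum.cong) (auto simp: kl)
    also have "\<dots> = bicoeff f k l ^ q"
      using fin \<open>q > 0\<close> by (simp add: sum.delta S_def)
    finally show ?thesis using \<open>q > 0\<close> by (simp add: kl)
  next
    case False
    then show ?thesis by (intro trans[OF sum.neutral]) auto
  qed
  finally show ?thesis .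
qed

text \<open>
  This is flatness of the Frobenius map for the monomial ideals \<open>(x\<^sup>r, y\<^sup>r)\<close>.
\<close>

lemma frob_power_frobenius_iff:
  fixes g :: "'a::idom poly poly"
  assumes "prime CHAR('a)" and q: "q = CHAR('a) ^ e"
  shows "g ^ q \<in> frob_power (q * r) \<longleftrightarrow> g \<in> frob_power r"
proof -
  have "q > 0" using assms by (simp add: prime_gt_0_nat)
  show ?thesis
  proof
    assume "g ^ q \<in> frob_power (q * r)"
    then have *: "bicoeff (g ^ q) (q * i) (q * j) = 0" if "i < r" "j < r" for i j
      using that \<open>q > 0\<close> by (simp add: frob_power_iff)
    show "g \<in> frob_power r"
      unfolding frob_power_iff
    proof (intro allI impI)
      fix i j assume "i < r" "j < r"
      have "bicoeff (g ^ q) (q * i) (q * j) = bicoeff g i j ^ q"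
        using \<open>q > 0\<close> by (simp add: bicoeff_frobenius[OF assms])
      with *[OF \<open>i < r\<close> \<open>j < r\<close>] show "bicoeff g i j = 0" by simp
    qed
  next
    assume "g \<in> frob_power r"
    then show "g ^ q \<in> frob_power (q * r)"
      using \<open>q > 0\<close>
      by (auto simp: frob_power_iff bicoeff_frobenius[OF assms] zero_power elim!: dvdE)
  qed
qed

text \<open>
  In degree \<open>(q - 1)(a + b)\<close> the monomial \<open>(xy)\<^sup>q\<^sup>-\<^sup>1\<close> is the only one outside \<open>(x\<^sup>q, y\<^sup>q)\<close>.
\<close>

lemma whomog_socle_decomposition:
  fixes g :: "'a::comm_ring_1 poly poly"
  assumes "a > 0" "b > 0" and g: "whomog a b ((int q - 1) * (int a + int b)) g"
    and out: "g \<notin> frob_power q"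
  obtains c where "c \<noteq> 0" "g - bimonom c (q - 1) (q - 1) \<in> frob_power q"
proof
  have corner: "i = q - 1 \<and> j = q - 1" if ij: "i < q" "j < q" "bicoeff g i j \<noteq> 0" for i j
  proof -
    have "int (a * i + b * j) = (int q - 1) * (int a + int b)"
      using g ij(3) unfolding whomog_def by blast
    then have "int a * (int q - 1 - int i) + int b * (int q - 1 - int j) = 0"
      by (simp add: algebra_simps)
    moreover have "int a * (int q - 1 - int i) \<ge> 0" "int b * (int q - 1 - int j) \<ge> 0"
      using ij by auto
    ultimately have "int a * (int q - 1 - int i) = 0" "int b * (int q - 1 - int j) = 0"
      by linarith+
    then show ?thesis using assms(1,2) by auto
  qed
  show "bicoeff g (q - 1) (q - 1) \<noteq> 0"
    using out corner unfolding frob_power_iff by metis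
  show "g - bimonom (bicoeff g (q - 1) (q - 1)) (q - 1) (q - 1) \<in> frob_power q"
    unfolding frob_power_iff
  proof (intro allI impI)
    fix i j assume "i < q" "j < q"
    then have "\<not> (i = q - 1 \<and> j = q - 1) \<longrightarrow> bicoeff g i j = 0" using corner by blast
    then show "bicoeff (g - bimonom (bicoeff g (q - 1) (q - 1)) (q - 1) (q - 1)) i j = 0"
      unfolding coeff_diff bicoeff_bimonom
      by (cases "i = q - 1 \<and> j = q - 1") (simp_all only: if_True if_False diff_self diff_zero simp_thms)
  qed
qed

text \<open>
  Modulo the respective ideals \<open>g\<close> is a multiple of \<open>(xy)\<^sup>q\<^sup>-\<^sup>1\<close> and \<open>k\<close> one of \<open>(xy)\<^sup>r\<^sup>-\<^sup>1\<close>, so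
  \<open>g k\<^sup>q\<close> is one of \<open>(xy)\<^bsup>q r - 1\<^esup>\<close>, because \<open>(q - 1) + q (r - 1) = q r - 1\<close>.
\<close>

lemma socle_power_product:
  fixes g k :: "'a::idom poly poly"
  assumes "prime CHAR('a)" and q: "q = CHAR('a) ^ e" and "r > 0"
    and "a > 0" "b > 0"
    and g: "whomog a b ((int q - 1) * (int a + int b)) g" "g \<notin> frob_power q"
    and k: "whomog a b ((int r - 1) * (int a + int b)) k" "k \<notin> frob_power r"
  shows "g * k ^ q \<notin> frob_power (q * r)"
proof
  assume prod: "g * k ^ q \<in> frob_power (q * r)"
  have "q > 0" using assms(1,2) by (simp add: prime_gt_0_nat)
  obtain c where c: "c \<noteq> 0" "g - bimonom c (q - 1) (q - 1) \<in> frob_power q"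
    using whomog_socle_decomposition[OF \<open>a > 0\<close> \<open>b > 0\<close> g] .
  obtain c' where c': "c' \<noteq> 0" "k - bimonom c' (r - 1) (r - 1) \<in> frob_power r"
    using whomog_socle_decomposition[OF \<open>a > 0\<close> \<open>b > 0\<close> k] .
  define m where "m = bimonom (c' ^ q) ((r - 1) * q) ((r - 1) * q)"
  define G where "G = (k - bimonom c' (r - 1) (r - 1)) ^ q"
  have G: "G \<in> frob_power (q * r)"
    unfolding G_def using frob_power_frobenius_iff[OF assms(1,2)] c'(2) by blast
  have "((k - bimonom c' (r - 1) (r - 1)) + bimonom c' (r - 1) (r - 1)) ^ q
      = G + bimonom c' (r - 1) (r - 1) ^ q"
    unfolding G_def by (rule freshmans_dream'[where n = e]) (use assms(1,2) in simp_all)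
  then have kq: "k ^ q = G + m"
    by (simp add: m_def monom_power)
  have "bimonom (c' ^ q) ((r - 1) * q) ((r - 1) * q) * (g - bimonom c (q - 1) (q - 1))
      \<in> frob_power (q * r)"
    unfolding frob_power_iff bicoeff_bimonom_mult
  proof (intro allI impI)
    fix i j assume "i < q * r" "j < q * r"
    then have "i - (r - 1) * q < q" "j - (r - 1) * q < q"
      using \<open>q > 0\<close> \<open>r > 0\<close> by (simp_all add: algebra_simps)
    then have "bicoeff (g - bimonom c (q - 1) (q - 1)) (i - (r - 1) * q) (j - (r - 1) * q) = 0"
      using c(2) unfolding frob_power_iff by blast
    then show "(if (r - 1) * q \<le> i \<and> (r - 1) * q \<le> j
      then c' ^ q * bicoeff (g - bimonom c (q - 1) (q - 1)) (i - (r - 1) * q) (j - (r - 1) * q)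
      else 0) = 0"
      by (simp only: mult_zero_right if_cancel)
  qed
  then have "g * k ^ q - (g * G + m * (g - bimonom c (q - 1) (q - 1))) \<in> frob_power (q * r)"
    unfolding m_def[symmetric] by (rule frob_power_diff[OF prod frob_power_add[OF frob_power_mult[OF G]]])
  moreover have "g * k ^ q - (g * G + m * (g - bimonom c (q - 1) (q - 1)))
      = m * bimonom c (q - 1) (q - 1)"
    unfolding kq by (simp add: algebra_simps)
  moreover have "(r - 1) * q + (q - 1) = q * r - 1"
    using \<open>q > 0\<close> \<open>r > 0\<close> by (cases r) (simp_all add: algebra_simps)
  ultimately have "bimonom (c' ^ q * c) (q * r - 1) (q * r - 1) \<in> frob_power (q * r)"
    by (simp add: m_def mult_monom)
  moreover have "q * r - 1 < q * r" using \<open>q > 0\<close> \<open>r > 0\<close> by simp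
  ultimately have "c' ^ q * c = 0" unfolding frob_power_iff bicoeff_bimonom by presburger
  with c(1) c'(1) show False by simp
qed

section \<open>The function nu\<close>

text \<open>
  The exponents \<open>N\<close> with \<open>f\<^sup>N\<close> outside \<open>(x\<^sup>q, y\<^sup>q)\<close> are bounded by degree reasons, and they are closed
  downwards because ideals absorb multiplication; so their maximum determines them all.
\<close>

lemma le_nu_iff:
  fixes f :: "'a::idom poly poly"
  assumes f: "whomog a b d f" and "d > 0" "q > 0"
  shows "n \<le> nu f q \<longleftrightarrow> f ^ n \<notin> frob_power q"
proof -
  define S where "S = {n. f ^ n \<notin> frob_power q}"
  have "n \<le> nat ((int q - 1) * (int a + int b))" if "n \<in> S" for n
  proof -
    have "int n * d \<le> (int q - 1) * (int a + int b)"
      using whomog_not_in_frob_power[OF whomog_power[OF f, of n]] that unfolding S_def by blast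
    moreover have "int n * 1 \<le> int n * d" using \<open>d > 0\<close> by (intro mult_left_mono) auto
    ultimately show ?thesis by linarith
  qed
  then have "S \<subseteq> {..nat ((int q - 1) * (int a + int b))}" by blast
  then have fin: "finite S" by (rule finite_subset) simp
  have "0 \<in> S" using \<open>q > 0\<close> by (auto simp: S_def frob_power_iff)
  then have "nu f q \<in> S" unfolding nu_def S_def[symmetric] using Max_in[OF fin] by blast
  moreover have "n \<in> S" if "n \<le> m" "m \<in> S" for n m
  proof -
    have "f ^ m = f ^ (m - n) * f ^ n" using \<open>n \<le> m\<close> by (simp flip: power_add)
    then show ?thesis
      using \<open>m \<in> S\<close> frob_power_mult[of "f ^ n" q "f ^ (m - n)"] unfolding S_def by auto
  qed
  moreover have "n \<le> nu f q" if "n \<in> S" for n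
    unfolding nu_def S_def[symmetric] using Max_ge[OF fin that] .
  ultimately show ?thesis unfolding S_def by blast
qed

lemma nu_bound:
  fixes f :: "'a::idom poly poly"
  assumes f: "whomog a b (int D) f" and "D > 0" "q > 0"
  shows "D * nu f q + (a + b) \<le> q * (a + b)"
proof -
  have "f ^ nu f q \<notin> frob_power q"
    using le_nu_iff[OF f, of q "nu f q"] \<open>D > 0\<close> \<open>q > 0\<close> by simp
  then have "int (nu f q) * int D \<le> (int q - 1) * (int a + int b)"
    by (rule whomog_not_in_frob_power[OF whomog_power[OF f]])
  then have "int (D * nu f q + (a + b)) \<le> int (q * (a + b))"
    by (simp add: algebra_simps)
  then show ?thesis by (simp only: of_nat_le_iff)
qed

lemma nu_frobenius:
  fixes f :: "'a::idom poly poly"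
  assumes "whomog a b d f" "d > 0" "prime CHAR('a)" and q: "q = CHAR('a) ^ e" and "r > 0"
  shows "q * nu f r \<le> nu f (q * r)" "nu f (q * r) < q * (nu f r + 1)"
proof -
  have "q * r > 0" using assms by (simp add: prime_gt_0_nat)
  have *: "q * n \<le> nu f (q * r) \<longleftrightarrow> n \<le> nu f r" for n
    unfolding le_nu_iff[OF assms(1,2) \<open>q * r > 0\<close>] le_nu_iff[OF assms(1,2) \<open>r > 0\<close>]
    using frob_power_frobenius_iff[OF assms(3,4), of "f ^ n" r] by (simp add: mult.commute flip: power_mult)
  show "q * nu f r \<le> nu f (q * r)" by (simp add: *)
  show "nu f (q * r) < q * (nu f r + 1)" unfolding not_le[symmetric] * by simp
qed

section \<open>The threshold from the numerical data\<close>

text \<open>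
  What the limit needs to know about \<open>f\<close>, with \<open>\<nu> e\<close> in the role of \<open>nu f (p ^ e)\<close>: \<open>u e\<close> and \<open>r e\<close>
  are quotient and remainder of \<open>p ^ e * A\<close> by \<open>D\<close>, with remainders from \<open>1\<close> to \<open>D\<close>.
\<close>

locale threshold_numerics =
  fixes p A D :: nat and \<nu> u r :: "nat \<Rightarrow> nat"
  assumes p: "p \<ge> 2" and A: "0 < A" "A \<le> D"
    and ur: "\<And>e. D * u e + r e = p ^ e * A" and r: "\<And>e. 0 < r e" "\<And>e. r e \<le> D"
    and bound: "\<And>e. D * \<nu> e + A \<le> p ^ e * A"
    and frob: "\<And>e. p * \<nu> e \<le> \<nu> (Suc e)" "\<And>e. \<nu> (Suc e) < p * (\<nu> e + 1)"
    and gap: "\<And>e. e \<ge> 1 \<Longrightarrow> \<not> p dvd \<nu> e + 1 \<Longrightarrow> (p ^ e + 1) * A \<le> D * (\<nu> e + 2)"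
begin

lemma D_pos: "D > 0"
  using A by linarith

lemma D_u_less: "D * u e < p ^ e * A"
  using ur[of e] r(1)[of e] by linarith

lemma less_D_u: "p ^ e * A \<le> D * (u e + 1)"
  using ur[of e] r(2)[of e] by simp

lemma \<nu>_le_u: "\<nu> e \<le> u e"
proof -
  have "D * \<nu> e < p ^ e * A" using bound[of e] A(1) by linarith
  also note less_D_u
  finally show ?thesis unfolding mult_less_cancel1 by simp
qed

lemma \<nu>_0: "\<nu> 0 = 0" and u_0: "u 0 = 0"
proof -
  show "\<nu> 0 = 0" using bound[of 0] D_pos by simp
  have "D * u 0 < D * 1"
    using D_u_less[of 0] A(2) unfolding power_0 mult_1 mult_1_right by linarith
  then show "u 0 = 0" unfolding mult_less_cancel1 by simp
qed

text \<open>
  Since \<open>\<nu> (L - 1) = u (L - 1)\<close>, the number \<open>\<nu> L + 1 \<le> u L\<close> lies strictly between two consecutive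
  multiples of \<open>p\<close>, so the gap estimate applies and leaves \<open>u L\<close> as its only value.  Later on the
  estimate can never apply again: the quantity \<open>p ^ (e - L) * u L\<close> stays below \<open>p ^ e * A / D\<close>,
  so \<open>\<nu> e + 1\<close> must remain divisible by \<open>p\<close>, and being as large as possible is the only way.
\<close>

lemma first_deviation:
  assumes L: "\<nu> L \<noteq> u L" and least: "\<And>e. e < L \<Longrightarrow> \<nu> e = u e"
  shows "L \<ge> 1" and "e \<ge> L \<Longrightarrow> \<nu> e + 1 = p ^ (e - L) * u L"
proof -
  have "L \<noteq> 0" using L \<nu>_0 u_0 by metis
  then obtain K where K: "L = Suc K" using not0_implies_Suc by blast
  show "L \<ge> 1" using K by simp
  have K_eq: "\<nu> K = u K" using least K by simp
  have less: "\<nu> L < u L" using L \<nu>_le_u[of L] by simp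
  have "D * u L < p ^ L * A" by (rule D_u_less)
  also have "p ^ L * A \<le> p * (D * (u K + 1))"
    using mult_le_mono2[OF less_D_u[of K], of p] by (simp add: K mult.assoc)
  finally have "D * u L < D * (p * (u K + 1))" by (simp only: mult.left_commute)
  then have "u L < p * (u K + 1)" by simp
  then have upper: "\<nu> L + 1 < p * (u K + 1)" using less by linarith
  have lower: "p * u K < \<nu> L + 1" using frob(1)[of K] by (simp add: K K_eq)
  have "\<not> p dvd \<nu> L + 1"
  proof
    assume "p dvd \<nu> L + 1"
    then obtain k where k: "\<nu> L + 1 = p * k" ..
    show False using lower upper unfolding k mult_less_cancel1 by simp
  qed
  from gap[OF \<open>L \<ge> 1\<close> this] have "p ^ L * A < D * (\<nu> L + 2)" using A(1) by simp
  with D_u_less[of L] have "D * u L < D * (\<nu> L + 2)" by linarith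
  then have at_L: "\<nu> L + 1 = u L" using less unfolding mult_less_cancel1 by simp
  show "\<nu> e + 1 = p ^ (e - L) * u L" if "e \<ge> L"
    using that
  proof (induction e rule: dec_induct)
    case base
    show ?case using at_L by simp
  next
    case (step e)
    have pow: "p ^ (Suc e - L) = p * p ^ (e - L)" using step.hyps by (simp add: Suc_diff_le)
    have T: "p ^ (Suc e - L) * u L = p * (\<nu> e + 1)"
      unfolding pow step.IH by (simp add: mult.assoc)
    show ?case
    proof (cases "p dvd \<nu> (Suc e) + 1")
      case True
      then obtain k where k: "\<nu> (Suc e) + 1 = p * k" ..
      have "p * \<nu> e < p * k" using frob(1)[of e] k by linarith
      moreover have "p * k \<le> p * (\<nu> e + 1)" using frob(2)[of e] k by linarith
      ultimately have "k = \<nu> e + 1"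
        using p unfolding mult_less_cancel1 mult_le_cancel1 by simp
      then show ?thesis using k T by simp
    next
      case False
      show ?thesis
      proof (rule ccontr)
        assume "\<nu> (Suc e) + 1 \<noteq> p ^ (Suc e - L) * u L"
        then have le: "\<nu> (Suc e) + 2 \<le> p ^ (Suc e - L) * u L"
          using frob(2)[of e] unfolding T by linarith
        have "p ^ Suc e * A < D * (\<nu> (Suc e) + 2)"
          using gap[OF _ False] A(1) by simp
        also have "\<dots> \<le> D * (p ^ (Suc e - L) * u L)" using le by (rule mult_le_mono2)
        also have "\<dots> = p ^ (Suc e - L) * (D * u L)" by (simp only: mult.left_commute)
        also have "\<dots> \<le> p ^ (Suc e - L) * (p ^ L * A)"
          using D_u_less[of L] by (intro mult_le_mono2) simp
        also have "\<dots> = p ^ Suc e * A"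
          using step.hyps by (simp only: mult.assoc[symmetric] power_add[symmetric]) simp
        finally show False by simp
      qed
    qed
  qed
qed

lemma inverse_powers_tendsto_0: "(\<lambda>e. 1 / real (p ^ e)) \<longlonglongrightarrow> 0"
proof -
  have "(\<lambda>e. (1 / real p) ^ e) \<longlonglongrightarrow> 0"
    using p by (intro LIMSEQ_power_zero) simp
  then show ?thesis by (simp add: power_divide)
qed

lemma lim_without_deviation:
  assumes "\<And>e. \<nu> e = u e"
  shows "(\<lambda>e. real (\<nu> e) / real (p ^ e)) \<longlonglongrightarrow> real A / real D"
proof (rule tendsto_sandwich)
  have pos: "real (p ^ e) > 0 \<and> real D > 0" for e using p D_pos by simp
  show "\<forall>\<^sub>F e in sequentially. real A / real D - 1 / real (p ^ e) \<le> real (\<nu> e) / real (p ^ e)"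
  proof (rule always_eventually, rule allI)
    fix e
    have "real (p ^ e * A) \<le> real (D * (u e + 1))"
      using less_D_u[of e] by (simp only: of_nat_le_iff)
    then have "real A * real (p ^ e) \<le> (real (u e) + 1) * real D"
      by (simp only: of_nat_mult of_nat_add of_nat_1 mult.commute)
    then have "real A / real D \<le> (real (u e) + 1) / real (p ^ e)"
      using pos[of e] by (simp only: pos_divide_le_eq pos_le_divide_eq times_divide_eq_left)
    then show "real A / real D - 1 / real (p ^ e) \<le> real (\<nu> e) / real (p ^ e)"
      unfolding assms by (simp add: add_divide_distrib)
  qed
  show "\<forall>\<^sub>F e in sequentially. real (\<nu> e) / real (p ^ e) \<le> real A / real D"
  proof (rule always_eventually, rule allI)
    fix e
    have "real (D * u e) \<le> real (p ^ e * A)"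
      using D_u_less[of e] by (simp only: of_nat_le_iff)
    then have "real (u e) * real D \<le> real A * real (p ^ e)"
      by (simp only: of_nat_mult mult.commute)
    then show "real (\<nu> e) / real (p ^ e) \<le> real A / real D"
      using pos[of e] unfolding assms
      by (simp only: pos_divide_le_eq pos_le_divide_eq times_divide_eq_left)
  qed
  show "(\<lambda>e. real A / real D - 1 / real (p ^ e)) \<longlonglongrightarrow> real A / real D"
    using tendsto_diff[OF tendsto_const inverse_powers_tendsto_0] by simp
qed simp

lemma lim_first_deviation:
  assumes "\<And>e. e \<ge> L \<Longrightarrow> \<nu> e + 1 = p ^ (e - L) * u L"
  shows "(\<lambda>e. real (\<nu> e) / real (p ^ e))
    \<longlonglongrightarrow> real A / real D - real (r L) / real (p ^ L * D)"
proof -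
  have slope: "real (u L) / real (p ^ L) = real A / real D - real (r L) / real (p ^ L * D)"
  proof -
    have "real D * real (u L) + real (r L) = real (p ^ L) * real A"
      using ur[of L] by (metis of_nat_add of_nat_mult)
    then show ?thesis using p D_pos by (simp add: field_simps)
  qed
  have "(\<lambda>e. real (u L) / real (p ^ L) - 1 / real (p ^ e)) \<longlonglongrightarrow> real (u L) / real (p ^ L)"
    using tendsto_diff[OF tendsto_const inverse_powers_tendsto_0] by simp
  moreover have "\<forall>\<^sub>F e in sequentially.
      real (u L) / real (p ^ L) - 1 / real (p ^ e) = real (\<nu> e) / real (p ^ e)"
  proof (rule eventually_sequentiallyI)
    fix e assume "e \<ge> L"
    then have "real (\<nu> e) + 1 = real p ^ (e - L) * real (u L)"
      using assms[of e] by (metis of_nat_1 of_nat_add of_nat_mult of_nat_power)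
    moreover have "real p ^ e = real p ^ (e - L) * real p ^ L"
      using \<open>e \<ge> L\<close> by (simp flip: power_add)
    moreover have "real p ^ (e - L) > 0" using p by simp
    ultimately have "real (p ^ e) * real (u L) = (real (\<nu> e) + 1) * real (p ^ L)"
      by simp
    moreover have "real (p ^ e) > 0" "real (p ^ L) > 0" using p by simp_all
    ultimately have "real (u L) / real (p ^ L) = (real (\<nu> e) + 1) / real (p ^ e)"
      by (simp only: frac_eq_eq mult.commute)
    then show "real (u L) / real (p ^ L) - 1 / real (p ^ e) = real (\<nu> e) / real (p ^ e)"
      by (simp add: add_divide_distrib)
  qed
  ultimately show ?thesis unfolding slope[symmetric] by (rule Lim_transform_eventually)
qed

end

section \<open>Residues\<close>

text \<open>
  The bound \<open>r \<le> m\<close> makes \<open>m - r\<close> a genuine subtraction of natural numbers.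
\<close>

lemma least_pos_residue_props:
  fixes m D :: nat
  assumes "m > 0" "D > 0"
  defines "r \<equiv> least_pos_residue (int m) (int D)"
  shows "0 < r" "r \<le> D" "[r = m] (mod D)" "r \<le> m"
proof -
  define P where "P = (\<lambda>r::nat. 0 < r \<and> [int r = int m] (mod int D))"
  have r: "r = (LEAST r. P r)" unfolding r_def least_pos_residue_def P_def ..
  have Pm: "P m" using assms by (simp add: P_def)
  have "P r" unfolding r using Pm by (rule LeastI)
  then show "0 < r" "[r = m] (mod D)" by (auto simp: P_def cong_int_iff)
  show "r \<le> m" unfolding r using Pm by (rule Least_le)
  show "r \<le> D"
  proof (rule ccontr)
    assume "\<not> r \<le> D"
    then have "P (r - D)"
      using \<open>P r\<close> by (auto simp: P_def cong_def of_nat_diff)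
    then have "r \<le> r - D" unfolding r by (rule Least_le)
    with \<open>\<not> r \<le> D\<close> assms(2) show False by simp
  qed
qed

lemma least_pos_residue_unique:
  assumes "0 < s" "s \<le> D" "[s = m] (mod D)" "m > 0"
  shows "least_pos_residue (int m) (int D) = s"
proof -
  define r where "r = least_pos_residue (int m) (int D)"
  have r: "0 < r" "r \<le> D" "[r = m] (mod D)"
    using least_pos_residue_props[of m D] assms unfolding r_def by auto
  have "[r = s] (mod D)" using r(3) assms(3) by (metis cong_sym cong_trans)
  then have "r = s"
    using r assms(1,2) by (cases "r = D"; cases "s = D")
      (auto simp: cong_def dest: le_neq_implies_less)
  then show ?thesis by (simp add: r_def)
qed

section \<open>Homogeneous polynomials with isolated singularity\<close>

lemma wdeg_homogeneous:
  assumes "homogeneous a b f"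
  shows "whomog a b (int (wdeg a b f)) f"
proof -
  obtain d where "f \<noteq> 0" and d: "\<And>i j. bicoeff f i j \<noteq> 0 \<Longrightarrow> a * i + b * j = d"
    using assms unfolding homogeneous_def by blast
  obtain i j where "bicoeff f i j \<noteq> 0"
    using \<open>f \<noteq> 0\<close> bipoly_eqI[of f 0] by auto
  then have "{a * i + b * j | i j. bicoeff f i j \<noteq> 0} = {d}"
    using d by blast
  then have "wdeg a b f = d" unfolding wdeg_def by simp
  with d show ?thesis unfolding whomog_def by simp
qed

lemma wdeg_xy: "wdeg a b (var_x * var_y :: 'a::comm_ring_1 poly poly) = a + b"
proof -
  have xy: "(var_x * var_y :: 'a poly poly) = bimonom 1 1 1"
    using arg_cong2[OF var_x_power[of 1] var_y_power[of 1], of "(*)"]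
    by (simp add: mult_monom)
  have "{a * i + b * j | i j. bicoeff (var_x * var_y :: 'a poly poly) i j \<noteq> 0} = {a + b}"
    unfolding xy bicoeff_bimonom by auto
  then show ?thesis unfolding wdeg_def by simp
qed

lemma Jac_contains_powers:
  assumes "ideal_radical (Jac f) = max_ideal"
  obtains N where "var_x ^ N \<in> Jac f" "var_y ^ N \<in> Jac f"
proof -
  have "var_x = 1 * var_x + 0 * var_y" "var_y = 0 * var_x + 1 * var_y"
    by simp_all
  then have "var_x \<in> ideal_radical (Jac f)" "var_y \<in> ideal_radical (Jac f)"
    unfolding assms max_ideal_def ideal_generated_by_pair_iff by blast+
  then obtain M N where MN: "var_x ^ M \<in> Jac f" "var_y ^ N \<in> Jac f"
    unfolding ideal_radical_def by blast
  have ideal: "h * g \<in> Jac f" if "g \<in> Jac f" for g h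
    using that unfolding Jac_def by (rule ideal_generated_by_pair_mult)
  show ?thesis
  proof (rule that)
    show "var_x ^ (N + M) \<in> Jac f" unfolding power_add by (rule ideal[OF MN(1)])
    show "var_y ^ (N + M) \<in> Jac f" unfolding add.commute[of N] power_add by (rule ideal[OF MN(2)])
  qed
qed

text \<open>
  The hypothesis says that \<open>f ^ nu f q\<close> has the degree of \<open>(xy)\<^sup>q\<^sup>-\<^sup>1\<close>, the largest degree possible
  outside \<open>(x\<^sup>q, y\<^sup>q)\<close>.  Multiplying with Frobenius twists of itself keeps a power of \<open>f\<close> extremal.
\<close>

lemma nu_Frobenius_periodic:
  fixes f :: "'a::idom poly poly"
  assumes "prime CHAR('a)" and q: "q = CHAR('a) ^ e"
    and f: "whomog a b (int D) f" and "D > 0" "a > 0" "b > 0"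
    and start: "D * nu f q + (a + b) = q * (a + b)"
  shows "D * nu f (q ^ k) + (a + b) = q ^ k * (a + b)"
proof (induction k)
  case 0
  show ?case using nu_bound[OF f \<open>D > 0\<close>, of 1] \<open>D > 0\<close> by simp
next
  case (Suc k)
  have "q > 0" using assms(1,2) by (simp add: prime_gt_0_nat)
  have socle: "whomog a b ((int s - 1) * (int a + int b)) (f ^ nu f s)" "f ^ nu f s \<notin> frob_power s"
    if "s > 0" "D * nu f s + (a + b) = s * (a + b)" for s
  proof -
    have "int (D * nu f s + (a + b)) = int (s * (a + b))" using that(2) by simp
    then have "int (nu f s) * int D = (int s - 1) * (int a + int b)"
      by (simp add: algebra_simps)
    then show "whomog a b ((int s - 1) * (int a + int b)) (f ^ nu f s)"
      using whomog_power[OF f, of "nu f s"] by simp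
    show "f ^ nu f s \<notin> frob_power s"
      using le_nu_iff[OF f, of s "nu f s"] \<open>D > 0\<close> that(1) by simp
  qed
  have "f ^ nu f q * (f ^ nu f (q ^ k)) ^ q \<notin> frob_power (q * q ^ k)"
    using socle_power_product[OF assms(1,2) _ \<open>a > 0\<close> \<open>b > 0\<close>
        socle[OF \<open>q > 0\<close> start] socle[OF _ Suc]] \<open>q > 0\<close> by simp
  then have "f ^ (nu f q + q * nu f (q ^ k)) \<notin> frob_power (q ^ Suc k)"
    by (simp add: power_add mult.commute flip: power_mult)
  then have "nu f q + q * nu f (q ^ k) \<le> nu f (q ^ Suc k)"
    using le_nu_iff[OF f, of "q ^ Suc k"] \<open>D > 0\<close> \<open>q > 0\<close> by simp
  then have "D * (nu f q + q * nu f (q ^ k)) + (a + b) \<le> D * nu f (q ^ Suc k) + (a + b)"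
    by simp
  moreover have "D * (nu f q + q * nu f (q ^ k)) + (a + b)
      = (D * nu f q + (a + b)) + q * (D * nu f (q ^ k))"
    by (simp add: algebra_simps)
  moreover have "\<dots> = q * (D * nu f (q ^ k) + (a + b))"
    unfolding start by (simp add: algebra_simps)
  moreover have "\<dots> = q ^ Suc k * (a + b)" unfolding Suc by (simp add: mult.assoc)
  moreover have "D * nu f (q ^ Suc k) + (a + b) \<le> q ^ Suc k * (a + b)"
    by (rule nu_bound[OF f \<open>D > 0\<close>]) (use \<open>q > 0\<close> in simp)
  ultimately show ?case by linarith
qed

theorem fpt_isolated_singularity:
  fixes f :: "'a::idom poly poly" and a b D p :: nat
  assumes char: "p = CHAR('a)" "prime p" and ab: "a > 0" "b > 0"
    and f: "whomog a b (int D) f" and D: "a + b \<le> D" "\<not> p dvd D"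
    and Jac: "var_x ^ N \<in> Jac f" "var_y ^ N \<in> Jac f"
    and ne: "fpt p f \<noteq> real (a + b) / real D"
  shows "\<exists>L\<ge>1. L \<le> ord D p \<and> fpt p f = real (a + b) / real D
    - real (least_pos_residue (int (p ^ L * (a + b))) (int D)) / real (p ^ L * D)"
proof -
  define A where "A = a + b"
  define \<nu> where "\<nu> = (\<lambda>e. nu f (p ^ e))"
  define r where "r = (\<lambda>e. least_pos_residue (int (p ^ e * A)) (int D))"
  define u where "u = (\<lambda>e. (p ^ e * A - r e) div D)"
  have "p \<ge> 2" "p > 0" using char(2) prime_ge_2_nat prime_gt_0_nat by blast+
  have "A > 0" "A \<le> D" "D > 0" using ab D(1) by (simp_all add: A_def)
  have prime: "prime CHAR('a)" using char by simp
  have r: "0 < r e" "r e \<le> D" "[r e = p ^ e * A] (mod D)" "r e \<le> p ^ e * A" for e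
    using least_pos_residue_props[of "p ^ e * A" D] \<open>p > 0\<close> \<open>A > 0\<close> \<open>D > 0\<close> by (simp_all add: r_def)
  have ur: "D * u e + r e = p ^ e * A" for e
  proof -
    have "D dvd p ^ e * A - r e" using r(3,4)[of e] by (metis cong_sym cong_altdef_nat)
    then show ?thesis using r(4)[of e] by (simp add: u_def)
  qed
  interpret threshold_numerics p A D \<nu> u r
  proof
    show "p \<ge> 2" "0 < A" "A \<le> D" by fact+
    show "D * u e + r e = p ^ e * A" "0 < r e" "r e \<le> D" for e
      by (rule ur r)+
    show "D * \<nu> e + A \<le> p ^ e * A" for e
      using nu_bound[OF f \<open>D > 0\<close>, of "p ^ e"] \<open>p > 0\<close> by (simp add: \<nu>_def A_def)
    show "p * \<nu> e \<le> \<nu> (Suc e)" "\<nu> (Suc e) < p * (\<nu> e + 1)" for e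
      using nu_frobenius[OF f _ prime, of p 1 "p ^ e"] char(1) \<open>D > 0\<close> \<open>p > 0\<close>
      by (simp_all add: \<nu>_def)
    show "(p ^ e + 1) * A \<le> D * (\<nu> e + 2)" if "e \<ge> 1" "\<not> p dvd \<nu> e + 1" for e
    proof -
      have "p ^ e > 0" "int D > 0" using \<open>p > 0\<close> \<open>D > 0\<close> by simp_all
      have "of_nat (p ^ e) = (0::'a)" "of_nat (Suc (\<nu> e)) \<noteq> (0::'a)"
        using that char(1) by (simp_all add: of_nat_eq_0_iff_char_dvd dvd_power del: of_nat_Suc)
      moreover have "f ^ \<nu> e \<notin> frob_power (p ^ e)" "f ^ Suc (\<nu> e) \<in> frob_power (p ^ e)"
        using le_nu_iff[OF f \<open>int D > 0\<close> \<open>p ^ e > 0\<close>] unfolding \<nu>_def by (blast, metis not_less_eq_eq order_refl)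
      ultimately have "(int (p ^ e) + 1) * (int a + int b) \<le> int D * (int (\<nu> e) + 2)"
        by (rule exponent_gap[OF f Jac])
      then have "int ((p ^ e + 1) * A) \<le> int (D * (\<nu> e + 2))"
        by (simp add: A_def algebra_simps)
      then show ?thesis by (simp only: of_nat_le_iff)
    qed
  qed
  have fpt: "fpt p f = x" if "(\<lambda>e. real (\<nu> e) / real (p ^ e)) \<longlonglongrightarrow> x" for x
    using that unfolding fpt_def \<nu>_def by (rule limI)
  have "\<exists>L. \<nu> L \<noteq> u L"
    using lim_without_deviation fpt ne unfolding A_def by blast
  then obtain L where L: "\<nu> L \<noteq> u L" and least: "\<And>e. e < L \<Longrightarrow> \<nu> e = u e"
    using exists_least_iff[of "\<lambda>L. \<nu> L \<noteq> u L"] by blast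
  have deviation: "L \<ge> 1" "\<And>e. e \<ge> L \<Longrightarrow> \<nu> e + 1 = p ^ (e - L) * u L"
    using first_deviation[OF L] least by blast+
  have "L \<le> ord D p"
  proof (rule ccontr)
    define o' where "o' = ord D p"
    assume "\<not> L \<le> ord D p"
    then have "\<nu> o' = u o'" using least by (simp add: o'_def)
    have "coprime p D" using char(2) D(2) by (simp add: prime_imp_coprime)
    then have "o' > 0" unfolding o'_def by (simp add: coprime_commute)
    \<comment> \<open>As \<open>A \<le> D\<close>, the residue of \<open>p ^ o' * A\<close> is \<open>A\<close>, and \<open>f ^ \<nu> o'\<close> has extremal degree.\<close>
    have "[p ^ o' * A = 1 * A] (mod D)"
      unfolding o'_def by (intro cong_mult ord cong_refl)
    then have "r o' = A"
      unfolding r_def using \<open>A > 0\<close> \<open>A \<le> D\<close> \<open>p > 0\<close>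
      by (intro least_pos_residue_unique) (simp_all add: cong_sym)
    then have "D * nu f (p ^ o') + (a + b) = p ^ o' * (a + b)"
      using ur[of o'] \<open>\<nu> o' = u o'\<close> by (simp add: \<nu>_def A_def)
    then have "D * nu f ((p ^ o') ^ L) + (a + b) = (p ^ o') ^ L * (a + b)"
      using nu_Frobenius_periodic[OF prime _ f \<open>D > 0\<close> ab] char(1) by simp
    then have "D * \<nu> (o' * L) + A = p ^ (o' * L) * A"
      by (simp add: \<nu>_def A_def power_mult)
    \<comment> \<open>Beyond \<open>L\<close> extremality fails: \<open>D * \<nu> e + D < p ^ e * A\<close> there, while \<open>A \<le> D\<close>.\<close>
    moreover have "L \<le> o' * L" using \<open>o' > 0\<close> by simp
    from deviation(2)[OF this] have "D * (\<nu> (o' * L) + 1) = p ^ (o' * L - L) * (D * u L)"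
      by (simp only: mult.left_commute)
    moreover have "p ^ (o' * L - L) * (D * u L) < p ^ (o' * L - L) * (p ^ L * A)"
      using D_u_less[of L] \<open>p > 0\<close> by simp
    moreover have "p ^ (o' * L - L) * (p ^ L * A) = p ^ (o' * L) * A"
      using \<open>L \<le> o' * L\<close> by (simp only: mult.assoc[symmetric] power_add[symmetric]) simp
    ultimately show False using \<open>A \<le> D\<close> by simp
  qed
  moreover have "fpt p f = real A / real D - real (r L) / real (p ^ L * D)"
    by (intro fpt lim_first_deviation deviation(2))
  ultimately show ?thesis using deviation(1) unfolding A_def r_def by blast
qed

theorem theoremA:
  fixes p a b :: nat
    and f :: "('p::prime_card) mod_ring poly poly"
  assumes "p = CARD('p)"
    and "a > 0" and "b > 0"
    and "homogeneous a b f"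
    and "ideal_radical (Jac f) = max_ideal"
    and "wdeg a b f \<ge> wdeg a b (var_x * var_y :: 'p mod_ring poly poly)"
    and "\<not> p dvd wdeg a b f"
    and "fpt p f \<noteq> real (wdeg a b (var_x * var_y :: 'p mod_ring poly poly)) / real (wdeg a b f)"
  shows "\<exists>L::nat. 1 \<le> L \<and> L \<le> ord (wdeg a b f) p \<and>
    fpt p f =
      real (wdeg a b (var_x * var_y :: 'p mod_ring poly poly)) / real (wdeg a b f)
      - real (least_pos_residue
                (int (p ^ L * wdeg a b (var_x * var_y :: 'p mod_ring poly poly)))
                (int (wdeg a b f)))
        / real (p ^ L * wdeg a b f)"
proof -
  have p: "p = CHAR('p mod_ring)" "prime p"
    using assms(1) by (simp_all add: prime_card)
  obtain N where "var_x ^ N \<in> Jac f" "var_y ^ N \<in> Jac f"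
    using Jac_contains_powers[OF assms(5)] .
  with fpt_isolated_singularity[OF p assms(2,3) wdeg_homogeneous[OF assms(4)]] assms(6-8)
  show ?thesis unfolding wdeg_xy by blast
qed

end
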